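(* (High SNR slope with Gaussian noise jamming.) Let $0<\alpha<1$, $0<\eta<1$, $\beta=\frac{1-\alpha}{2\eta\alpha}$, $\xi>0$, and let $p_R,p_J\in[0,1]$ be constants (the power outage probabilities at the relay and the jammer). Let $X,Y,Z,W,U$ be independent exponential random variables with positive means $m_x,m_y,m_z,m_w,m_u$. For $\rho>0$ define $$\bar R_{Sec}^{WoJ}(\rho)=(1-p_R)\,\mathbb E\left\{\left[\frac{1-\alpha}{2}\log_2\frac{\left(1+\frac{\rho XY}{X+\beta}\right)\left(1+\frac{\xi\rho XY}{Y+\beta}\right)}{1+\rho(\xi X+Y)}\right]^+\right\},$$ $$\gamma_R=\frac{\rho(\xi X+Y)}{\beta^{-1}\rho(\xi Z+W)U+1},$$ $$\gamma_{S_1}=\frac{\rho XY}{(\xi Z+W)\left(\frac{\rho X}{\beta}+\frac{1}{\xi X+Y}\right)U+X+\beta},\qquad \gamma_{S_2}=\frac{\xi\rho XY}{(\xi Z+W)\left(\frac{\rho Y}{\beta}+\frac{1}{\xi X+Y}\right)U+Y+\beta},$$ $$\bar R_{Act}^{GNJ}(\rho)=\mathbb E\left\{\left[\frac{1-\alpha}{2}\log_2\frac{(1+\gamma_{S_1})(1+\gamma_{S_2})}{1+\gamma_R}\right]^+\right\},$$ $$\bar R_{Sec}^{GNJ}(\rho)=p_J\,\bar R_{Sec}^{WoJ}(\rho)+(1-p_R)(1-p_J)\,\bar R_{Act}^{GNJ}(\rho).$$ Then the high SNR slope is $$S_\infty^{GNJ}:=\lim_{\rho\to\infty}\frac{\bar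 R_{Sec}^{GNJ}(\rho)}{\log_2\rho}=p_J(1-p_R)\frac{1-\alpha}{2}.$$
   Context: $[x]^+=\max(x,0)$. In the model, two sources with transmit powers $P_1=\xi P_2$ communicate through an untrusted energy-harvesting relay, in the presence of an energy-harvesting jammer whose signal is unknown to the sources; $\rho=P_2/N_0$ is the transmit SNR ($N_0$ the noise power); $X,Y$ are the channel power gains from sources 1, 2 to the relay, $Z,W$ those from sources 1, 2 to the jammer, $U$ that of jammer–relay; $\bar R_{Sec}^{GNJ}$ is the ergodic secrecy sum rate. *)

theory Defs
  imports "HOL-Probability.Probability"
begin

text \<open>
  Lower-case \<open>x y z w u\<close> are realisations of the power gains \<open>X Y Z W U\<close>.
  At realisations where a denominator vanishes the value is the conventional \<open>a / 0 = 0\<close>;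
  for exponential gains this happens with probability zero.
\<close>

definition pos_part :: "real \<Rightarrow> real" where
  "pos_part r = max r 0"

text \<open>Instantaneous secrecy sum rate without jamming, before the \<open>pos_part\<close>.\<close>

definition rate_WoJ :: "real \<Rightarrow> real \<Rightarrow> real \<Rightarrow> real \<Rightarrow> real \<Rightarrow> real \<Rightarrow> real" where
  "rate_WoJ \<alpha> \<beta> \<xi> \<rho> x y =
     (1 - \<alpha>) / 2 * log 2
       ((1 + \<rho> * x * y / (x + \<beta>)) * (1 + \<xi> * \<rho> * x * y / (y + \<beta>)) / (1 + \<rho> * (\<xi> * x + y)))"

definition gamma_R :: "real \<Rightarrow> real \<Rightarrow> real \<Rightarrow> real \<Rightarrow> real \<Rightarrow> real \<Rightarrow> real \<Rightarrow> real \<Rightarrow> real" where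
  "gamma_R \<beta> \<xi> \<rho> x y z w u =
     \<rho> * (\<xi> * x + y) / (inverse \<beta> * \<rho> * (\<xi> * z + w) * u + 1)"

definition gamma_S1 :: "real \<Rightarrow> real \<Rightarrow> real \<Rightarrow> real \<Rightarrow> real \<Rightarrow> real \<Rightarrow> real \<Rightarrow> real \<Rightarrow> real" where
  "gamma_S1 \<beta> \<xi> \<rho> x y z w u =
     \<rho> * x * y / ((\<xi> * z + w) * (\<rho> * x / \<beta> + 1 / (\<xi> * x + y)) * u + x + \<beta>)"

definition gamma_S2 :: "real \<Rightarrow> real \<Rightarrow> real \<Rightarrow> real \<Rightarrow> real \<Rightarrow> real \<Rightarrow> real \<Rightarrow> real \<Rightarrow> real" where
  "gamma_S2 \<beta> \<xi> \<rho> x y z w u =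
     \<xi> * \<rho> * x * y / ((\<xi> * z + w) * (\<rho> * y / \<beta> + 1 / (\<xi> * x + y)) * u + y + \<beta>)"

text \<open>Instantaneous secrecy sum rate with the jammer active, before the \<open>pos_part\<close>.\<close>

definition rate_Act_GNJ ::
    "real \<Rightarrow> real \<Rightarrow> real \<Rightarrow> real \<Rightarrow> real \<Rightarrow> real \<Rightarrow> real \<Rightarrow> real \<Rightarrow> real \<Rightarrow> real" where
  "rate_Act_GNJ \<alpha> \<beta> \<xi> \<rho> x y z w u =
     (1 - \<alpha>) / 2 * log 2
       ((1 + gamma_S1 \<beta> \<xi> \<rho> x y z w u) * (1 + gamma_S2 \<beta> \<xi> \<rho> x y z w u)
         / (1 + gamma_R \<beta> \<xi> \<rho> x y z w u))"

definition R_Sec_WoJ ::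
    "'a measure \<Rightarrow> ('a \<Rightarrow> real) \<Rightarrow> ('a \<Rightarrow> real) \<Rightarrow> real \<Rightarrow> real \<Rightarrow> real \<Rightarrow> real \<Rightarrow> real \<Rightarrow> real" where
  "R_Sec_WoJ M X Y p\<^sub>R \<alpha> \<beta> \<xi> \<rho> =
     (1 - p\<^sub>R) * (LINT \<omega>|M. pos_part (rate_WoJ \<alpha> \<beta> \<xi> \<rho> (X \<omega>) (Y \<omega>)))"

definition R_Act_GNJ ::
    "'a measure \<Rightarrow> ('a \<Rightarrow> real) \<Rightarrow> ('a \<Rightarrow> real) \<Rightarrow> ('a \<Rightarrow> real) \<Rightarrow> ('a \<Rightarrow> real) \<Rightarrow> ('a \<Rightarrow> real)
       \<Rightarrow> real \<Rightarrow> real \<Rightarrow> real \<Rightarrow> real \<Rightarrow> real" where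
  "R_Act_GNJ M X Y Z W U \<alpha> \<beta> \<xi> \<rho> =
     (LINT \<omega>|M. pos_part (rate_Act_GNJ \<alpha> \<beta> \<xi> \<rho> (X \<omega>) (Y \<omega>) (Z \<omega>) (W \<omega>) (U \<omega>)))"

definition R_Sec_GNJ ::
    "'a measure \<Rightarrow> ('a \<Rightarrow> real) \<Rightarrow> ('a \<Rightarrow> real) \<Rightarrow> ('a \<Rightarrow> real) \<Rightarrow> ('a \<Rightarrow> real) \<Rightarrow> ('a \<Rightarrow> real)
       \<Rightarrow> real \<Rightarrow> real \<Rightarrow> real \<Rightarrow> real \<Rightarrow> real \<Rightarrow> real \<Rightarrow> real" where
  "R_Sec_GNJ M X Y Z W U p\<^sub>R p\<^sub>J \<alpha> \<beta> \<xi> \<rho> =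
     p\<^sub>J * R_Sec_WoJ M X Y p\<^sub>R \<alpha> \<beta> \<xi> \<rho>
     + (1 - p\<^sub>R) * (1 - p\<^sub>J) * R_Act_GNJ M X Y Z W U \<alpha> \<beta> \<xi> \<rho>"

end

(*
  Divided by log2 rho, the instantaneous rates are dominated, for rho >= 2, by an integrable
  affine function of X and Y, so it suffices to take pointwise limits.  Without jamming all three
  SNR factors grow linearly in rho, giving 1 + 1 - 1 = 1.  With an active jammer the jamming power
  also scales with rho, so all three factors converge to positive constants and the limit is 0.
*)
theory Submission
  imports Defs "HOL-Real_Asymp.Real_Asymp"
begin

text \<open>The factor \<open>1 + c\<close> is at least 1, so dividing by it only lowers the
  logarithm. Each numerator factor is at most \<open>\<rho> * (1 + s)\<close> or
  \<open>\<rho> * (1 + t)\<close>, which splits off one \<open>log 2 \<rho>\<close>; division by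
  \<open>log 2 \<rho>\<close> then leaves a bound free of \<open>\<rho>\<close>.\<close>

lemma pos_part_log_bound:
  fixes \<rho> :: real
  assumes "2 \<le> \<rho>" "0 \<le> \<kappa>" "0 \<le> a" "a \<le> \<rho> * s" "0 \<le> b" "b \<le> \<rho> * t" "0 \<le> c"
  shows "norm (pos_part (\<kappa> * log 2 ((1 + a) * (1 + b) / (1 + c))) / log 2 \<rho>)
          \<le> \<kappa> * (2 + (s + t) / ln 2)"
proof -
  have s: "0 \<le> s" and t: "0 \<le> t"
    using assms zero_le_mult_iff[of \<rho> s] zero_le_mult_iff[of \<rho> t] by linarith+
  have L: "1 \<le> log 2 \<rho>" using assms by (simp add: le_log_iff)
  have log1: "log 2 (1 + v) \<le> log 2 \<rho> * (1 + r / ln 2)" if "0 \<le> v" "v \<le> \<rho> * r" "0 \<le> r" for v r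
  proof -
    have "log 2 (1 + v) \<le> log 2 (\<rho> * (1 + r))"
      using that assms by (simp add: algebra_simps)
    also have "\<dots> = log 2 \<rho> + log 2 (1 + r)"
      using that assms by (intro log_mult_pos) auto
    also have "\<dots> \<le> log 2 \<rho> + r / ln 2"
      using that ln_add_one_self_le_self[of r] by (simp add: log_def divide_right_mono)
    \<comment> \<open>Here \<open>\<rho> \<ge> 2\<close> matters:
      \<open>log 2 \<rho> \<ge> 1\<close> turns the additive constant into a multiple of
      \<open>log 2 \<rho>\<close>.\<close>
    also have "\<dots> \<le> log 2 \<rho> + log 2 \<rho> * (r / ln 2)"
      using L that mult_right_mono[of 1 "log 2 \<rho>" "r / ln 2"] by simp
    finally show ?thesis by (simp add: algebra_simps)
  qed
  have "log 2 ((1 + a) * (1 + b) / (1 + c)) \<le> log 2 ((1 + a) * (1 + b))"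
    using assms divide_left_mono[of 1 "1 + c" "(1 + a) * (1 + b)"] by simp
  also have "\<dots> = log 2 (1 + a) + log 2 (1 + b)"
    using assms by (intro log_mult_pos) auto
  also have "\<dots> \<le> log 2 \<rho> * (2 + (s + t) / ln 2)"
    using log1[of a s] log1[of b t] assms s t by (simp add: algebra_simps add_divide_distrib)
  finally have "\<kappa> * log 2 ((1 + a) * (1 + b) / (1 + c)) \<le> \<kappa> * (log 2 \<rho> * (2 + (s + t) / ln 2))"
    using assms by (intro mult_left_mono)
  moreover have "0 \<le> \<kappa> * (log 2 \<rho> * (2 + (s + t) / ln 2))"
    using assms s t L by simp
  ultimately have "pos_part (\<kappa> * log 2 ((1 + a) * (1 + b) / (1 + c))) \<le> \<kappa> * (2 + (s + t) / ln 2) * log 2 \<rho>"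
    by (simp add: pos_part_def mult_ac)
  moreover have "0 \<le> pos_part (\<kappa> * log 2 ((1 + a) * (1 + b) / (1 + c)))"
    by (simp add: pos_part_def)
  ultimately show ?thesis
    using L by (simp add: divide_le_eq)
qed

text \<open>Dominated convergence along real \<open>\<rho>\<close>. Both ergodic rates are
  instances: \<open>a\<close>, \<open>b\<close> are the SNRs at the two sources, \<open>c\<close>
  the SNR at the relay, and \<open>l\<close> is the pointwise slope, 1 without and 0 with
  jamming.\<close>

lemma (in prob_space) ergodic_rate_slope:
  fixes a b c :: "real \<Rightarrow> 'a \<Rightarrow> real"
  assumes [measurable]: "\<And>\<rho>. a \<rho> \<in> borel_measurable M" "\<And>\<rho>. b \<rho> \<in> borel_measurable M"
      "\<And>\<rho>. c \<rho> \<in> borel_measurable M"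
    and st: "integrable M s" "integrable M t"
    and \<kappa>: "0 \<le> \<kappa>" and l: "0 \<le> l"
    and bounds: "\<And>\<rho>. 2 \<le> \<rho> \<Longrightarrow> AE \<omega> in M. 0 \<le> a \<rho> \<omega> \<and> a \<rho> \<omega> \<le> \<rho> * s \<omega> \<and>
        0 \<le> b \<rho> \<omega> \<and> b \<rho> \<omega> \<le> \<rho> * t \<omega> \<and> 0 \<le> c \<rho> \<omega>"
    and lim: "AE \<omega> in M.
        ((\<lambda>\<rho>. log 2 ((1 + a \<rho> \<omega>) * (1 + b \<rho> \<omega>) / (1 + c \<rho> \<omega>)) / log 2 \<rho>) \<longlongrightarrow> l) at_top"
  shows "((\<lambda>\<rho>. (LINT \<omega>|M. pos_part (\<kappa> * log 2 ((1 + a \<rho> \<omega>) * (1 + b \<rho> \<omega>) / (1 + c \<rho> \<omega>))))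
            / log 2 \<rho>) \<longlongrightarrow> \<kappa> * l) at_top"
proof -
  have "((\<lambda>\<rho>. LINT \<omega>|M. pos_part (\<kappa> * log 2 ((1 + a \<rho> \<omega>) * (1 + b \<rho> \<omega>) / (1 + c \<rho> \<omega>)))
            / log 2 \<rho>) \<longlongrightarrow> (LINT \<omega>|M. \<kappa> * l)) at_top"
  proof (rule integral_dominated_convergence_at_top)
    show "(\<lambda>\<omega>. pos_part (\<kappa> * log 2 ((1 + a \<rho> \<omega>) * (1 + b \<rho> \<omega>) / (1 + c \<rho> \<omega>))) / log 2 \<rho>)
        \<in> borel_measurable M" for \<rho>
      unfolding pos_part_def by measurable
    show "integrable M (\<lambda>\<omega>. \<kappa> * (2 + (s \<omega> + t \<omega>) / ln 2))"
      using st by auto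
    show "\<forall>\<^sub>F \<rho> in at_top. AE \<omega> in M.
        norm (pos_part (\<kappa> * log 2 ((1 + a \<rho> \<omega>) * (1 + b \<rho> \<omega>) / (1 + c \<rho> \<omega>))) / log 2 \<rho>)
          \<le> \<kappa> * (2 + (s \<omega> + t \<omega>) / ln 2)"
      using eventually_ge_at_top[of 2]
    proof eventually_elim
      case (elim \<rho>)
      show ?case
        using bounds[OF elim] by eventually_elim (intro pos_part_log_bound, auto simp: elim \<kappa>)
    qed
    show "AE \<omega> in M.
        ((\<lambda>\<rho>. pos_part (\<kappa> * log 2 ((1 + a \<rho> \<omega>) * (1 + b \<rho> \<omega>) / (1 + c \<rho> \<omega>))) / log 2 \<rho>)
          \<longlongrightarrow> \<kappa> * l) at_top"
      using lim
    proof eventually_elim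
      case (elim \<omega>)
      let ?q = "\<lambda>\<rho>. log 2 ((1 + a \<rho> \<omega>) * (1 + b \<rho> \<omega>) / (1 + c \<rho> \<omega>))"
      have "((\<lambda>\<rho>. max (\<kappa> * (?q \<rho> / log 2 \<rho>)) 0) \<longlongrightarrow> max (\<kappa> * l) 0) at_top"
        by (intro tendsto_intros elim)
      \<comment> \<open>For \<open>\<rho> > 1\<close> the divisor \<open>log 2 \<rho>\<close> is
        positive, so it commutes with the maximum.\<close>
      moreover have "\<forall>\<^sub>F \<rho> in at_top. max (\<kappa> * (?q \<rho> / log 2 \<rho>)) 0 = pos_part (\<kappa> * ?q \<rho>) / log 2 \<rho>"
        using eventually_gt_at_top[of 1]
        by eventually_elim (auto simp: pos_part_def max_def zero_le_divide_iff divide_le_0_iff)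
      \<comment> \<open>Since \<open>\<kappa> * l\<close> is nonnegative, the positive part leaves
        the limit unchanged.\<close>
      ultimately show ?case
        using \<kappa> l by (simp add: max_absorb1 tendsto_cong)
    qed
  qed auto
  then show ?thesis
    by (simp add: prob_space)
qed

text \<open>The density excludes negative values, and the point 0 is a Lebesgue null set. Strict
  positivity keeps all denominators of the SNRs positive almost surely.\<close>

lemma (in prob_space) AE_exponential_pos:
  assumes "distributed M lborel X (exponential_density m)"
  shows "AE \<omega> in M. 0 < X \<omega>"
proof -
  have "AE x in lborel. x \<noteq> (0 :: real)"
    by (rule AE_lborel_singleton)
  then have "AE x in lborel. 0 < ennreal (exponential_density m x) \<longrightarrow> 0 < x"
    by eventually_elim (auto simp: exponential_density_def split: if_splits)
  then show ?thesis
    by (subst distributed_AE2[OF assms]) auto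
qed

lemma (in prob_space) integrable_exponential:
  assumes "0 < m" "distributed M lborel X (exponential_density m)"
  shows "integrable M X"
  \<comment> \<open>An exponential law is the Erlang law of shape 0; \<open>1\<close> selects its
    first moment.\<close>
  using erlang_ith_moment_integrable[OF assms, of 1] by simp

text \<open>This is \<open>x / (d + x) \<le> 1\<close>. The bound does not involve \<open>d\<close>,
  which will hold \<open>\<beta>\<close> and any jamming power, so one dominating function serves
  both rates.\<close>

lemma scaled_harmonic_le:
  fixes x y :: real
  assumes "0 \<le> k" "0 < x" "0 < y" "0 \<le> d"
  shows "k * x * y / (d + x) \<le> k * y"
  using assms by (simp add: divide_le_eq algebra_simps)

text \<open>Positivity of \<open>l\<close> makes the numerator converge to the finite
  \<open>log 2 l\<close>, while the denominator diverges.\<close>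

lemma log_ratio_tendsto_0:
  fixes f :: "real \<Rightarrow> real"
  assumes "(f \<longlongrightarrow> l) at_top" "0 < l"
  shows "((\<lambda>\<rho>. log 2 (f \<rho>) / log 2 \<rho>) \<longlongrightarrow> 0) at_top"
proof (rule tendsto_divide_0)
  show "((\<lambda>\<rho>. log 2 (f \<rho>)) \<longlongrightarrow> log 2 l) at_top"
    using assms by (intro tendsto_intros) auto
  have "filterlim (log 2) at_top at_top"
    unfolding log_def by real_asymp
  then show "filterlim (log 2) at_infinity at_top"
    by (rule filterlim_at_top_imp_at_infinity)
qed

text \<open>With \<open>p > 0\<close> the noise grows as fast as the signal and the ratio saturates
  at \<open>k / p\<close>. Only the sign of this limit matters later.\<close>

lemma jammed_snr_converges:
  fixes k p d :: real
  assumes "0 \<le> k" "0 < p"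
  obtains l where "0 \<le> l" "((\<lambda>\<rho>. \<rho> * k / (p * \<rho> + d)) \<longlongrightarrow> l) at_top"
proof
  show "0 \<le> k / p" using assms by simp
  have "((\<lambda>\<rho>. k * (\<rho> / (p * \<rho> + d))) \<longlongrightarrow> k * (1 / p)) at_top"
    using assms by (intro tendsto_mult tendsto_const) (real_asymp simp: field_simps)
  then show "((\<lambda>\<rho>. \<rho> * k / (p * \<rho> + d)) \<longlongrightarrow> k / p) at_top"
    by (simp add: mult_ac)
qed

theorem mainTheorem7:
  fixes M :: "'a measure"
    and X Y Z W U :: "'a \<Rightarrow> real"
    and \<alpha> \<eta> \<beta> \<xi> p\<^sub>R p\<^sub>J m\<^sub>x m\<^sub>y m\<^sub>z m\<^sub>w m\<^sub>u :: real
  assumes "prob_space M"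
    and "0 < \<alpha>" "\<alpha> < 1"
    and "0 < \<eta>" "\<eta> < 1"
    and "\<beta> = (1 - \<alpha>) / (2 * \<eta> * \<alpha>)"
    and "\<xi> > 0"
    and "p\<^sub>R \<in> {0..1}" "p\<^sub>J \<in> {0..1}"
    and "m\<^sub>x > 0" "m\<^sub>y > 0" "m\<^sub>z > 0" "m\<^sub>w > 0" "m\<^sub>u > 0"
    and "prob_space.indep_vars M (\<lambda>_. borel) (\<lambda>i. [X, Y, Z, W, U] ! i) {..<5}"
    and "distributed M lborel X (exponential_density (1 / m\<^sub>x))"
    and "distributed M lborel Y (exponential_density (1 / m\<^sub>y))"
    and "distributed M lborel Z (exponential_density (1 / m\<^sub>z))"
    and "distributed M lborel W (exponential_density (1 / m\<^sub>w))"
    and "distributed M lborel U (exponential_density (1 / m\<^sub>u))"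
  shows "((\<lambda>\<rho>. R_Sec_GNJ M X Y Z W U p\<^sub>R p\<^sub>J \<alpha> \<beta> \<xi> \<rho> / log 2 \<rho>)
           \<longlongrightarrow> p\<^sub>J * (1 - p\<^sub>R) * ((1 - \<alpha>) / 2)) at_top"
proof -
  interpret prob_space M by fact
  have [measurable]: "X \<in> borel_measurable M" "Y \<in> borel_measurable M" "Z \<in> borel_measurable M"
      "W \<in> borel_measurable M" "U \<in> borel_measurable M"
    using assms(16-20) by (auto dest: distributed_measurable)
  have \<xi>: "0 < \<xi>" and \<beta>: "0 < \<beta>"
    using assms by auto
  have int: "integrable M Y" "integrable M (\<lambda>\<omega>. \<xi> * X \<omega>)"
    using integrable_exponential[OF _ assms(16)] integrable_exponential[OF _ assms(17)] assms(10,11)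
    by auto
  have pos: "AE \<omega> in M. 0 < X \<omega> \<and> 0 < Y \<omega> \<and> 0 < Z \<omega> \<and> 0 < W \<omega> \<and> 0 < U \<omega>"
    using assms(16-20)[THEN AE_exponential_pos] by eventually_elim simp
  \<comment> \<open>\<open>d\<close> is the jamming contribution, 0 without a jammer. Cancelling
    \<open>x\<close> in the first SNR and \<open>y\<close> in the second leaves the integrable
    bounds \<open>Y\<close> and \<open>\<xi> * X\<close>.\<close>
  have snr1: "\<rho> * x * y / (d + (x + \<beta>)) \<le> \<rho> * y"
    and snr2: "\<xi> * \<rho> * x * y / (d + (y + \<beta>)) \<le> \<rho> * (\<xi> * x)"
    if "0 < x" "0 < y" "0 \<le> d" "2 \<le> \<rho>" for \<rho> x y d :: real
    using scaled_harmonic_le[of \<rho> x y "d + \<beta>"] scaled_harmonic_le[of "\<xi> * \<rho>" y x "d + \<beta>"]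
      that \<beta> \<xi> by (simp_all add: mult_ac add_ac)

  have "((\<lambda>\<rho>. (LINT \<omega>|M. pos_part (rate_WoJ \<alpha> \<beta> \<xi> \<rho> (X \<omega>) (Y \<omega>))) / log 2 \<rho>)
      \<longlongrightarrow> (1 - \<alpha>) / 2 * 1) at_top"
    unfolding rate_WoJ_def
  proof (rule ergodic_rate_slope[where s = Y and t = "\<lambda>\<omega>. \<xi> * X \<omega>"])
    show "AE \<omega> in M. 0 \<le> \<rho> * X \<omega> * Y \<omega> / (X \<omega> + \<beta>) \<and>
        \<rho> * X \<omega> * Y \<omega> / (X \<omega> + \<beta>) \<le> \<rho> * Y \<omega> \<and>
        0 \<le> \<xi> * \<rho> * X \<omega> * Y \<omega> / (Y \<omega> + \<beta>) \<and>
        \<xi> * \<rho> * X \<omega> * Y \<omega> / (Y \<omega> + \<beta>) \<le> \<rho> * (\<xi> * X \<omega>) \<and>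
        0 \<le> \<rho> * (\<xi> * X \<omega> + Y \<omega>)" if "2 \<le> \<rho>" for \<rho>
      using pos
    proof eventually_elim
      case (elim \<omega>)
      then show ?case
        using snr1[of "X \<omega>" "Y \<omega>" 0 \<rho>] snr2[of "X \<omega>" "Y \<omega>" 0 \<rho>] that \<beta> \<xi> by simp
    qed
    show "AE \<omega> in M. ((\<lambda>\<rho>. log 2 ((1 + \<rho> * X \<omega> * Y \<omega> / (X \<omega> + \<beta>)) *
        (1 + \<xi> * \<rho> * X \<omega> * Y \<omega> / (Y \<omega> + \<beta>)) / (1 + \<rho> * (\<xi> * X \<omega> + Y \<omega>))) / log 2 \<rho>) \<longlongrightarrow> 1) at_top"
      using pos
    proof eventually_elim
      case (elim \<omega>)
      \<comment> \<open>Each factor contributes one \<open>log 2 \<rho>\<close> to leading order,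
        two in the numerator and one in the denominator.\<close>
      have lin: "((\<lambda>\<rho>. log 2 ((1 + \<rho> * a) * (1 + \<rho> * b) / (1 + \<rho> * c)) / log 2 \<rho>) \<longlongrightarrow> 1) at_top"
        if "0 < a" "0 < b" "0 < c" for a b c :: real
        using that unfolding log_def by real_asymp
      show ?case
        using lin[of "X \<omega> * Y \<omega> / (X \<omega> + \<beta>)" "\<xi> * X \<omega> * Y \<omega> / (Y \<omega> + \<beta>)" "\<xi> * X \<omega> + Y \<omega>"] elim \<beta> \<xi>
        by (simp add: mult_ac add_pos_pos)
    qed
  qed (use assms int in auto)
  then have WoJ: "((\<lambda>\<rho>. R_Sec_WoJ M X Y p\<^sub>R \<alpha> \<beta> \<xi> \<rho> / log 2 \<rho>) \<longlongrightarrow> (1 - p\<^sub>R) * ((1 - \<alpha>) / 2)) at_top"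
    unfolding R_Sec_WoJ_def times_divide_eq_right[symmetric] mult_1_right
    by (intro tendsto_mult_left)

  \<comment> \<open>The product with 0 is kept to match the limit \<open>\<kappa> * l\<close> with
    \<open>l = 0\<close>.\<close>
  have "((\<lambda>\<rho>. R_Act_GNJ M X Y Z W U \<alpha> \<beta> \<xi> \<rho> / log 2 \<rho>) \<longlongrightarrow> (1 - \<alpha>) / 2 * 0) at_top"
    unfolding R_Act_GNJ_def rate_Act_GNJ_def
  proof (rule ergodic_rate_slope[where s = Y and t = "\<lambda>\<omega>. \<xi> * X \<omega>"])
    show "AE \<omega> in M. 0 \<le> gamma_S1 \<beta> \<xi> \<rho> (X \<omega>) (Y \<omega>) (Z \<omega>) (W \<omega>) (U \<omega>) \<and>
        gamma_S1 \<beta> \<xi> \<rho> (X \<omega>) (Y \<omega>) (Z \<omega>) (W \<omega>) (U \<omega>) \<le> \<rho> * Y \<omega> \<and>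
        0 \<le> gamma_S2 \<beta> \<xi> \<rho> (X \<omega>) (Y \<omega>) (Z \<omega>) (W \<omega>) (U \<omega>) \<and>
        gamma_S2 \<beta> \<xi> \<rho> (X \<omega>) (Y \<omega>) (Z \<omega>) (W \<omega>) (U \<omega>) \<le> \<rho> * (\<xi> * X \<omega>) \<and>
        0 \<le> gamma_R \<beta> \<xi> \<rho> (X \<omega>) (Y \<omega>) (Z \<omega>) (W \<omega>) (U \<omega>)" if "2 \<le> \<rho>" for \<rho>
      using pos
    proof eventually_elim
      case (elim \<omega>)
      then show ?case
        using snr1[of "X \<omega>" "Y \<omega>"
            "(\<xi> * Z \<omega> + W \<omega>) * (\<rho> * X \<omega> / \<beta> + 1 / (\<xi> * X \<omega> + Y \<omega>)) * U \<omega>" \<rho>]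
          snr2[of "X \<omega>" "Y \<omega>"
            "(\<xi> * Z \<omega> + W \<omega>) * (\<rho> * Y \<omega> / \<beta> + 1 / (\<xi> * X \<omega> + Y \<omega>)) * U \<omega>" \<rho>] that \<beta> \<xi>
        by (simp add: gamma_S1_def gamma_S2_def gamma_R_def add.assoc)
    qed
    show "AE \<omega> in M. ((\<lambda>\<rho>. log 2 ((1 + gamma_S1 \<beta> \<xi> \<rho> (X \<omega>) (Y \<omega>) (Z \<omega>) (W \<omega>) (U \<omega>)) *
        (1 + gamma_S2 \<beta> \<xi> \<rho> (X \<omega>) (Y \<omega>) (Z \<omega>) (W \<omega>) (U \<omega>)) /
        (1 + gamma_R \<beta> \<xi> \<rho> (X \<omega>) (Y \<omega>) (Z \<omega>) (W \<omega>) (U \<omega>))) / log 2 \<rho>) \<longlongrightarrow> 0) at_top"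
      using pos
    proof eventually_elim
      case (elim \<omega>)
      \<comment> \<open>\<open>v\<close> combines the gains from both sources to the jammer;
        \<open>\<rho> * v\<close> is the scale of the jamming power.\<close>
      define x y v u where "x = X \<omega>" and "y = Y \<omega>" and "v = \<xi> * Z \<omega> + W \<omega>" and "u = U \<omega>"
      have p: "0 < x" "0 < y" "0 < v" "0 < u"
        using elim \<xi> by (auto simp: x_def y_def v_def u_def add_pos_pos)
      obtain l1 where "0 \<le> l1" and
        l1: "((\<lambda>\<rho>. \<rho> * (x * y) / (v * x * u / \<beta> * \<rho> + (v * u / (\<xi> * x + y) + x + \<beta>))) \<longlongrightarrow> l1) at_top"
        using p \<beta> by (elim jammed_snr_converges[rotated 2]) auto
      obtain l2 where "0 \<le> l2" and
        l2: "((\<lambda>\<rho>. \<rho> * (\<xi> * x * y) / (v * y * u / \<beta> * \<rho> + (v * u / (\<xi> * x + y) + y + \<beta>))) \<longlongrightarrow> l2) at_top"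
        using p \<beta> \<xi> by (elim jammed_snr_converges[rotated 2]) auto
      obtain l3 where "0 \<le> l3" and
        l3: "((\<lambda>\<rho>. \<rho> * (\<xi> * x + y) / (v * u / \<beta> * \<rho> + 1)) \<longlongrightarrow> l3) at_top"
        using p \<beta> \<xi> by (elim jammed_snr_converges[rotated 2]) auto
      \<comment> \<open>For fixed gains every denominator is affine in \<open>\<rho>\<close>, with a
        positive leading coefficient due to the jammer.\<close>
      have gamma: "gamma_S1 \<beta> \<xi> \<rho> x y (Z \<omega>) (W \<omega>) u =
          \<rho> * (x * y) / (v * x * u / \<beta> * \<rho> + (v * u / (\<xi> * x + y) + x + \<beta>))"
        "gamma_S2 \<beta> \<xi> \<rho> x y (Z \<omega>) (W \<omega>) u =
          \<rho> * (\<xi> * x * y) / (v * y * u / \<beta> * \<rho> + (v * u / (\<xi> * x + y) + y + \<beta>))"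
        "gamma_R \<beta> \<xi> \<rho> x y (Z \<omega>) (W \<omega>) u = \<rho> * (\<xi> * x + y) / (v * u / \<beta> * \<rho> + 1)" for \<rho>
        unfolding gamma_S1_def gamma_S2_def gamma_R_def v_def[symmetric]
        by (simp_all add: divide_inverse distrib_left distrib_right mult_ac add_ac)
      then show ?case
        unfolding x_def[symmetric] y_def[symmetric] u_def[symmetric] gamma
        \<comment> \<open>As \<open>l1\<close>, \<open>l2\<close>, \<open>l3\<close> are
          nonnegative, the limiting ratio is finite and strictly positive, even if some SNR limit
          were 0.\<close>
        by (intro log_ratio_tendsto_0[where l = "(1 + l1) * (1 + l2) / (1 + l3)"]
            tendsto_divide tendsto_mult tendsto_add tendsto_const l1 l2 l3)
          (use \<open>0 \<le> l1\<close> \<open>0 \<le> l2\<close> \<open>0 \<le> l3\<close> in auto)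
    qed
  qed (use assms int in \<open>auto simp: gamma_S1_def gamma_S2_def gamma_R_def\<close>)
  \<comment> \<open>The weighted sum inherits its slope from the summand with weight
    \<open>p\<^sub>J\<close> alone, since the jammed rate has slope 0.\<close>
  then have "((\<lambda>\<rho>. p\<^sub>J * (R_Sec_WoJ M X Y p\<^sub>R \<alpha> \<beta> \<xi> \<rho> / log 2 \<rho>) +
      (1 - p\<^sub>R) * (1 - p\<^sub>J) * (R_Act_GNJ M X Y Z W U \<alpha> \<beta> \<xi> \<rho> / log 2 \<rho>))
      \<longlongrightarrow> p\<^sub>J * ((1 - p\<^sub>R) * ((1 - \<alpha>) / 2)) + (1 - p\<^sub>R) * (1 - p\<^sub>J) * ((1 - \<alpha>) / 2 * 0)) at_top"
    by (intro tendsto_add tendsto_mult_left WoJ)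
  then show ?thesis
    by (simp add: R_Sec_GNJ_def add_divide_distrib mult.assoc)
qed

end
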